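(* Let $(P,<)$ be a poset, let $f : \mathcal{P}(P) \to P$ be a function, and let $g : \mathcal{P}(P) \to \mathcal{P}(P)$ be defined by $g(C) := C \cup \{f(C)\}$. Then every chain of $P$ that is good for $g$ is well-ordered by $<$.
   Context: $\mathcal{P}(X)$ denotes the powerset of a set $X$. A chain in a poset $P$ is a linearly ordered subset of $P$ (the empty set is a chain). For $S \subseteq C \subseteq P$, $S$ is an (initial) segment of $C$, written $S \sqsubseteq C$, if for all $x \in C$ and $y \in S$, $x \leq y$ implies $x \in S$ (so $S \sqsubseteq C$ includes $S \subseteq C$). One writes $S \sqsubset C$ if $S \sqsubseteq C$ and $S \neq C$. Given $g : \mathcal{P}(P) \to \mathcal{P}(P)$, a chain $C \subseteq P$ is good for $g$ if for all $S \sqsubset C$ one has $S \sqsubset g(S)$ and $g(S) \sqsubseteq C$. *)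

theory Defs
  imports Main
begin

definition segment :: "'a::order set \<Rightarrow> 'a set \<Rightarrow> bool"  (infix "\<sqsubseteq>" 50) where
  "S \<sqsubseteq> C \<longleftrightarrow> S \<subseteq> C \<and> (\<forall>x\<in>C. \<forall>y\<in>S. x \<le> y \<longrightarrow> x \<in> S)"

definition strict_segment :: "'a::order set \<Rightarrow> 'a set \<Rightarrow> bool"  (infix "\<sqsubset>" 50) where
  "S \<sqsubset> C \<longleftrightarrow> S \<sqsubseteq> C \<and> S \<noteq> C"

definition good_for :: "('a::order set \<Rightarrow> 'a set) \<Rightarrow> 'a set \<Rightarrow> bool" where
  "good_for g C \<longleftrightarrow> Complete_Partial_Order.chain (\<le>) C
     \<and> (\<forall>S. S \<sqsubset> C \<longrightarrow> S \<sqsubset> g S \<and> g S \<sqsubseteq> C)"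

text \<open>The library's \<open>well_order_on\<close> takes the reflexive order relation as a set of pairs
  whose field is the carrier, so the ambient order has to be restricted to \<open>C\<close>; it asks that the
  strict part of this relation is well-founded.\<close>

definition well_ordered :: "'a::order set \<Rightarrow> bool" where
  "well_ordered C \<longleftrightarrow> well_order_on C {(x, y). x \<in> C \<and> y \<in> C \<and> x \<le> y}"

end

theory Submission
  imports Defs
begin

text \<open>Let \<open>T\<close> be a nonempty subset of a good chain \<open>C\<close>, and let \<open>S\<close> be the set of elements of
  \<open>C\<close> strictly below all of \<open>T\<close>. It is a proper segment of \<open>C\<close>, so by goodness \<open>S \<union> {f S}\<close> is a
  strictly larger segment of \<open>C\<close>: the point \<open>f S\<close> is the immediate successor of \<open>S\<close> in \<open>C\<close>.
  Hence \<open>f S\<close> is a lower bound of \<open>T\<close>, since an element of \<open>T\<close> below it would lie in \<open>S\<close>; and as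
  it is not strictly below all of \<open>T\<close>, it belongs to \<open>T\<close>. So \<open>T\<close> has a least element.\<close>

lemma good_chain_has_least:
  fixes f :: "'a::order set \<Rightarrow> 'a"
  assumes g: "\<And>A. g A = A \<union> {f A}" and good: "good_for g C"
    and T: "T \<subseteq> C" "T \<noteq> {}"
  shows "\<exists>m\<in>T. \<forall>t\<in>T. m \<le> t"
proof -
  define S where "S = {x \<in> C. \<forall>t\<in>T. x < t}"
  have "S \<sqsubseteq> C"
    unfolding segment_def S_def by (auto intro: le_less_trans)
  moreover have "S \<noteq> C"
    using T unfolding S_def by blast
  ultimately have "S \<sqsubset> g S" and gS: "g S \<sqsubseteq> C"
    using good by (simp_all add: good_for_def strict_segment_def)
  then have notin: "f S \<notin> S" and inC: "f S \<in> C"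
    by (auto simp: g strict_segment_def segment_def)
  have lower: "f S \<le> t" if t: "t \<in> T" for t
  proof (rule ccontr)
    assume "\<not> f S \<le> t"
    moreover have "t \<in> C"
      using t T by blast
    ultimately have "t \<le> f S"
      using good inC by (auto simp: good_for_def Complete_Partial_Order.chain_def)
    with gS \<open>t \<in> C\<close> have "t \<in> g S"
      by (auto simp: g segment_def)
    with \<open>\<not> f S \<le> t\<close> have "t \<in> S"
      by (auto simp: g)
    with t show False
      by (auto simp: S_def)
  qed
  from notin inC obtain t where "t \<in> T" "\<not> f S < t"
    by (auto simp: S_def)
  with lower have "f S \<in> T"
    by (metis order_le_imp_less_or_eq)
  with lower show ?thesis
    by blast
qed

theorem proposition9:
  fixes f :: "'a::order set \<Rightarrow> 'a" and g :: "'a set \<Rightarrow> 'a set" and C :: "'a set"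
  assumes "\<And>A. g A = A \<union> {f A}"
    and "good_for g C"
  shows "well_ordered C"
proof -
  let ?r = "{(x, y). x \<in> C \<and> y \<in> C \<and> x \<le> y}"
  have "linear_order_on C ?r"
    using assms(2)
    by (auto simp: order_on_defs refl_on_def trans_def antisym_def total_on_def
        good_for_def Complete_Partial_Order.chain_def)
  moreover have "wf (?r - Id)"
  proof (rule wfI_min)
    fix x :: 'a and Q
    assume "x \<in> Q"
    show "\<exists>z\<in>Q. \<forall>y. (y, z) \<in> ?r - Id \<longrightarrow> y \<notin> Q"
    proof (cases "Q \<inter> C = {}")
      case True
      with \<open>x \<in> Q\<close> show ?thesis by blast
    next
      case False
      then obtain m where "m \<in> Q \<inter> C" "\<forall>t\<in>Q \<inter> C. m \<le> t"
        using good_chain_has_least[OF assms, of "Q \<inter> C"] by blast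
      then show ?thesis
        by (intro bexI[of _ m]) (auto dest: order.antisym)
    qed
  qed
  ultimately show ?thesis
    by (simp add: well_ordered_def well_order_on_def)
qed

end
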